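(* Let $A$ be a set of cardinality $q>7$ and let $f$ be a function on $A$ with $N_2(f)=n$. Define an equivalence relation on $A$ by $x\sim_f x'$ if and only if $f(x)=f(x')$. Then $$V(f)=q-\mathrm{cost}(\sim_f)\le q-\mathrm{cost}(n).$$
   Context: For a function $f:A\to A$ on a finite set $A$: $V(f)=\#\{f(x): x\in A\}$, and $N_2(f)=\#\{(x_1,x_2)\in A^2 : x_1\neq x_2,\ f(x_1)=f(x_2)\}$ (ordered pairs). Let $\sim$ be an equivalence relation on a finite set whose equivalence classes have sizes $s_1,\dots,s_k$. Its total cost is $\mathrm{cost}(\sim)=\sum_{(x,x')}w(x,x')$, where $w(x,x')=1/s$ if $x\neq x'$ lie in a common equivalence class of size $s$, and $0$ otherwise; equivalently $\mathrm{cost}(\sim)=\sum_{i=1}^k(s_i-1)$. Its size is the number of equivalent ordered pairs of distinct elements, $||\sim||=\sum_{i=1}^k s_i(s_i-1)$. For an even natural number $n$, the minimum cost $\mathrm{cost}(n)$ is the minimum of $\mathrm{cost}(\sim)$ over all equivalence relations $\sim$ (on finite sets) of size $n$. *)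

theory Defs
  imports Complex_Main "HOL-Library.FuncSet"
begin

definition value_count :: "'a set \<Rightarrow> ('a \<Rightarrow> 'a) \<Rightarrow> nat" where
  "value_count A f = card (f ` A)"

definition N2 :: "'a set \<Rightarrow> ('a \<Rightarrow> 'a) \<Rightarrow> nat" where
  "N2 A f = card {(x1, x2) \<in> A \<times> A. x1 \<noteq> x2 \<and> f x1 = f x2}"

definition fibre_rel :: "'a set \<Rightarrow> ('a \<Rightarrow> 'b) \<Rightarrow> 'a rel" where
  "fibre_rel A f = {(x, x') \<in> A \<times> A. f x = f x'}"

lemma equiv_fibre_rel: "equiv A (fibre_rel A f)"
  by (rule equivI) (auto simp: fibre_rel_def refl_on_def sym_def trans_def)

(* In the following, r is meant to be an equivalence relation on the finite set A,
   so that r `` {x} is the equivalence class of x. *)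

definition weight :: "'a rel \<Rightarrow> 'a \<Rightarrow> 'a \<Rightarrow> real" where
  "weight r x x' = (if x \<noteq> x' \<and> (x, x') \<in> r then 1 / real (card (r `` {x})) else 0)"

definition total_cost :: "'a set \<Rightarrow> 'a rel \<Rightarrow> real" where
  "total_cost A r = (\<Sum>(x, x') \<in> A \<times> A. weight r x x')"

definition rel_size :: "'a rel \<Rightarrow> nat" where
  "rel_size r = card {(x, x') \<in> r. x \<noteq> x'}"

(* Cost and size are invariant under bijections and every finite set is in bijection
   with a finite set of natural numbers, so it suffices to let the underlying set range
   over finite sets of natural numbers.  Every size is even, so min_cost n is
   meaningful for even n only.  Costs are nonnegative integers, so the minimum exists
   for each such n. *)

definition min_cost :: "nat \<Rightarrow> real" where
  "min_cost n = (LEAST c. \<exists>(B :: nat set) r.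
     finite B \<and> equiv B r \<and> rel_size r = n \<and> c = total_cost B r)"

end

theory Submission
  imports Defs
begin

text \<open>
  Every element of a class of size \<open>s\<close> pays \<open>1 / s\<close> to each of the \<open>s - 1\<close> other elements
  of its class, so in total it pays \<open>1 - 1 / s\<close>.  The numbers \<open>1 / s\<close> add up to \<open>1\<close> over each
  class, hence the cost of the kernel of a function on \<open>A\<close> is the number of elements of \<open>A\<close>
  minus the number of values (\<open>total_cost_fibre_rel\<close>).  This is already the equation of the
  theorem.

  For the inequality, two points remain.  The relation \<open>\<sim>\<^sub>f\<close> lives on \<open>A\<close>, while
  the minimum cost ranges over sets of natural numbers; precomposing \<open>f\<close> with an enumeration
  of \<open>A\<close> changes neither the size nor the cost of its kernel.  And the minimum cost is a least
  real number, which is a lower bound only if it is attained; it is, because every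
  equivalence relation is the kernel of its class map, so that by the cost formula
  all costs are natural numbers (\<open>min_cost_le\<close>).
\<close>

lemma fibre_rel_Image:
  assumes "x \<in> A"
  shows "fibre_rel A f `` {x} = {z \<in> A. f z = f x}"
  using assms by (auto simp: fibre_rel_def)

lemma sum_weight_fibre_rel:
  assumes "finite A" "x \<in> A"
  shows "(\<Sum>x'\<in>A. weight (fibre_rel A f) x x') = 1 - 1 / real (card {z \<in> A. f z = f x})"
proof -
  let ?C = "{z \<in> A. f z = f x}"
  have C: "finite ?C" "x \<in> ?C"
    using assms by auto
  then have pos: "card ?C > 0"
    by (auto simp: card_gt_0_iff)
  have "weight (fibre_rel A f) x x' = (if x' \<in> ?C - {x} then 1 / real (card ?C) else 0)"
    if "x' \<in> A" for x'
    unfolding weight_def fibre_rel_Image[OF assms(2)]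
    by (rule if_cong) (use that assms(2) in \<open>auto simp: fibre_rel_def\<close>)
  then have "(\<Sum>x'\<in>A. weight (fibre_rel A f) x x')
      = (\<Sum>x'\<in>A. if x' \<in> ?C - {x} then 1 / real (card ?C) else 0)"
    by (rule sum.cong[OF refl])
  also have "\<dots> = (\<Sum>x'\<in>A \<inter> (?C - {x}). 1 / real (card ?C))"
    using assms(1) by (rule sum.inter_restrict[symmetric])
  also have "A \<inter> (?C - {x}) = ?C - {x}"
    by blast
  also have "(\<Sum>x'\<in>?C - {x}. 1 / real (card ?C)) = real (card (?C - {x})) / real (card ?C)"
    by simp
  also have "\<dots> = (real (card ?C) - 1) / real (card ?C)"
    using C pos by simp
  also have "\<dots> = 1 - 1 / real (card ?C)"
    using pos by (simp add: diff_divide_distrib)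
  finally show ?thesis .
qed

text \<open>Grouped by fibres, the numbers \<open>1 / s\<close> contribute \<open>1\<close> for each value of \<open>f\<close>.\<close>

lemma sum_inverse_fibre_card:
  assumes "finite A"
  shows "(\<Sum>x\<in>A. 1 / real (card {z \<in> A. f z = f x})) = real (card (f ` A))"
proof -
  have "(\<Sum>x\<in>A. 1 / real (card {z \<in> A. f z = f x}))
      = (\<Sum>y\<in>f ` A. \<Sum>x\<in>{x \<in> A. f x = y}. 1 / real (card {z \<in> A. f z = f x}))"
    using assms by (rule sum.image_gen)
  also have "\<dots> = (\<Sum>y\<in>f ` A. 1)"
  proof (rule sum.cong[OF refl])
    fix y
    assume "y \<in> f ` A"
    then have "card {z \<in> A. f z = y} \<noteq> 0"
      using assms by auto
    then show "(\<Sum>x\<in>{x \<in> A. f x = y}. 1 / real (card {z \<in> A. f z = f x})) = 1"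
      by simp
  qed
  finally show ?thesis by simp
qed

lemma total_cost_fibre_rel:
  assumes "finite A"
  shows "total_cost A (fibre_rel A f) = real (card A) - real (card (f ` A))"
proof -
  have "total_cost A (fibre_rel A f) = (\<Sum>x\<in>A. \<Sum>x'\<in>A. weight (fibre_rel A f) x x')"
    by (simp add: total_cost_def sum.cartesian_product)
  also have "\<dots> = (\<Sum>x\<in>A. 1 - 1 / real (card {z \<in> A. f z = f x}))"
    using assms by (simp add: sum_weight_fibre_rel)
  also have "\<dots> = real (card A) - real (card (f ` A))"
    using assms by (simp add: sum_subtractf sum_inverse_fibre_card)
  finally show ?thesis .
qed

lemma rel_size_fibre_rel: "rel_size (fibre_rel A f) = N2 A f"
  unfolding rel_size_def N2_def fibre_rel_def
  by (rule arg_cong[where f = card]) auto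

lemma equiv_eq_fibre_rel:
  assumes "equiv A r"
  shows "r = fibre_rel A (\<lambda>x. r `` {x})"
proof -
  have "(x, y) \<in> r \<longleftrightarrow> x \<in> A \<and> y \<in> A \<and> r `` {x} = r `` {y}" for x y
    using equiv_class_eq_iff[OF assms, of x y] by blast
  then show ?thesis
    unfolding fibre_rel_def by blast
qed

lemma total_cost_in_Nats:
  assumes "finite A" "equiv A r"
  shows "total_cost A r \<in> \<nat>"
proof -
  let ?c = "\<lambda>x. r `` {x}"
  have "total_cost A r = real (card A) - real (card (?c ` A))"
    using total_cost_fibre_rel[OF assms(1), of ?c] equiv_eq_fibre_rel[OF assms(2), symmetric]
    by (simp only:)
  also have "\<dots> = real (card A - card (?c ` A))"
    using card_image_le[OF assms(1), of ?c] by simp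
  finally show ?thesis by simp
qed

text \<open>A set of reals need not have a least element; a nonempty set of naturals does.\<close>

lemma Least_le_Nats:
  fixes P :: "real \<Rightarrow> bool"
  assumes "\<And>c. P c \<Longrightarrow> c \<in> \<nat>" and "P c"
  shows "(LEAST c. P c) \<le> c"
proof -
  define m where "m = (LEAST k. P (real k))"
  obtain k where k: "c = real k"
    using assms(1)[OF assms(2)] by (rule Nats_cases)
  have "P (real m)"
    unfolding m_def by (rule LeastI[of _ k]) (use assms(2) k in simp)
  moreover have le: "real m \<le> d" if d: "P d" for d
  proof -
    obtain j where "d = real j"
      using assms(1)[OF d] by (rule Nats_cases)
    then show ?thesis
      using d by (simp add: m_def Least_le)
  qed
  ultimately have "(LEAST c. P c) = real m"
    by (intro Least_equality)
  then show ?thesis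
    using le[OF assms(2)] by simp
qed

lemma min_cost_le:
  fixes B :: "nat set"
  assumes "finite B" "equiv B r"
  shows "min_cost (rel_size r) \<le> total_cost B r"
  unfolding min_cost_def
proof (rule Least_le_Nats)
  fix c
  assume "\<exists>(C :: nat set) s. finite C \<and> equiv C s \<and> rel_size s = rel_size r \<and> c = total_cost C s"
  then show "c \<in> \<nat>"
    by (elim exE conjE) (simp only: total_cost_in_Nats)
next
  show "\<exists>(C :: nat set) s. finite C \<and> equiv C s \<and> rel_size s = rel_size r
      \<and> total_cost B r = total_cost C s"
    by (rule exI[of _ B], rule exI[of _ r]) (simp add: assms)
qed

lemma rel_size_fibre_rel_comp:
  assumes "bij_betw g B A"
  shows "rel_size (fibre_rel B (f \<circ> g)) = rel_size (fibre_rel A f)"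
proof -
  have inj: "inj_on g B" and img: "g ` B = A"
    using assms by (auto simp: bij_betw_def)
  let ?P = "{(x, x') \<in> fibre_rel B (f \<circ> g). x \<noteq> x'}"
  let ?Q = "{(x, x') \<in> fibre_rel A f. x \<noteq> x'}"
  have "inj_on (map_prod g g) ?P"
    using inj by (auto simp: inj_on_def fibre_rel_def)
  moreover have "map_prod g g ` ?P = ?Q"
  proof
    show "map_prod g g ` ?P \<subseteq> ?Q"
      using inj img by (auto simp: fibre_rel_def inj_on_def)
    show "?Q \<subseteq> map_prod g g ` ?P"
    proof (clarify)
      fix y y'
      assume "(y, y') \<in> fibre_rel A f" "y \<noteq> y'"
      moreover from this obtain x x' where "x \<in> B" "x' \<in> B" "y = g x" "y' = g x'"
        using img by (auto simp: fibre_rel_def)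
      ultimately show "(y, y') \<in> map_prod g g ` ?P"
        by (intro image_eqI[of _ _ "(x, x')"]) (auto simp: fibre_rel_def)
    qed
  qed
  ultimately show ?thesis
    unfolding rel_size_def using card_image[of "map_prod g g" ?P] by simp
qed

text \<open>Transport along an enumeration carries the bound from sets of naturals to any finite set.\<close>

lemma min_cost_le_fibre_rel:
  assumes "finite A"
  shows "min_cost (rel_size (fibre_rel A f)) \<le> total_cost A (fibre_rel A f)"
proof -
  obtain g where g: "bij_betw g {0..<card A} A"
    using ex_bij_betw_nat_finite[OF assms] by blast
  let ?B = "{0..<card A}"
  have "min_cost (rel_size (fibre_rel ?B (f \<circ> g))) \<le> total_cost ?B (fibre_rel ?B (f \<circ> g))"
    by (intro min_cost_le equiv_fibre_rel) simp
  moreover have "(f \<circ> g) ` ?B = f ` A"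
    using g by (simp only: bij_betw_def image_comp[symmetric])
  then have "total_cost ?B (fibre_rel ?B (f \<circ> g)) = total_cost A (fibre_rel A f)"
    using assms by (simp add: total_cost_fibre_rel)
  ultimately show ?thesis
    using rel_size_fibre_rel_comp[OF g, of f] by simp
qed

theorem theorem3:
  fixes A :: "'a set" and f :: "'a \<Rightarrow> 'a" and q n :: nat
  assumes "finite A" and "card A = q" and "q > 7"
    and "f \<in> A \<rightarrow> A" and "N2 A f = n"
  shows "real (value_count A f) = real q - total_cost A (fibre_rel A f)
    \<and> real q - total_cost A (fibre_rel A f) \<le> real q - min_cost n"
proof
  show "real (value_count A f) = real q - total_cost A (fibre_rel A f)"
    using assms by (simp add: value_count_def total_cost_fibre_rel)
  have "min_cost n \<le> total_cost A (fibre_rel A f)"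
    using min_cost_le_fibre_rel[OF assms(1), of f] assms(5) by (simp add: rel_size_fibre_rel)
  then show "real q - total_cost A (fibre_rel A f) \<le> real q - min_cost n"
    by simp
qed

end
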